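(* Let $\mathcal S$ be the variety of symmetric $\mathcal I$-zroupoids and, for $1 \le i \le 14$, let $\mathcal S_i = \mathcal A_i \cap \mathcal S$. Then: (a) $\mathcal{SL}$, $\mathcal S_{14}$ and $\mathcal S$ are the subvarieties of $\mathcal S$ of associative type, and they are pairwise distinct (i.e. each $\mathcal S_i$, $1\le i\le 14$, equals one of these three, and the three are distinct). (b) $\mathcal{SL} \subset \mathcal S_{14} \subset \mathcal S$ (strict inclusions), and $\mathcal{BA} \not\subseteq \mathcal S_{14}$.
   Context: An $\mathcal I$-zroupoid is an algebra $\langle A,\to,0\rangle$ ($\to$ binary, $0$ constant) satisfying $(x \to y) \to z \approx [(z' \to x) \to (y \to z)']'$ and $0''\approx 0$, where $x' := x \to 0$ (prime binds tighter than $\to$); $\mathcal I$ is the variety of $\mathcal I$-zroupoids. Put $x \wedge y := (x \to y')'$. An $\mathcal I$-zroupoid is symmetric if it satisfies $x'' \approx x$ and $x \wedge y \approx y \wedge x$; $\mathcal S$ denotes the variety of symmetric $\mathcal I$-zroupoids. The identities (A1)–(A14) are: (A1) $x \to (y \to z) \approx (x \to y) \to z$; (A2) $x \to (y \to z) \approx x \to (z \to y)$; (A3) $x \to (y \to z) \approx (x \to z) \to y$; (A4) $x \to (y \to z) \approx y \to (x \to z)$; (A5) $x \to (y \to z) \approx (y \to x) \to z$; (A6) $x \to (y \to z) \approx y \to (z \to x)$; (A7) $x \to (y \to z) \approx (y \to z) \to x$; (A8) $x \to (y \to z) \approx (z \to x) \to y$; (A9) $x \to (y \to z) \approx z \to (y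 \to x)$; (A10) $x \to (y \to z) \approx (z \to y) \to x$; (A11) $(x \to y) \to z \approx (x \to z) \to y$; (A12) $(x \to y) \to z \approx (y \to x) \to z$; (A13) $(x \to y) \to z \approx (y \to z) \to x$; (A14) $(x \to y) \to z \approx (z \to y) \to x$. $\mathcal A_i$ is the subvariety of $\mathcal I$ defined by (Ai). A subvariety of $\mathcal S$ of associative type is one defined relative to $\mathcal S$ by a single identity $p\approx q$ in which each side contains exactly the three distinct variables $x,y,z$, each once, bracketed as $\star\to(\star\to\star)$ or $(\star\to\star)\to\star$ (each such variety equals some $\mathcal S_i$). $\mathcal{SL}$ is the subvariety of $\mathcal I$ defined by $x' \approx x$ and $x \to y \approx y \to x$. $\mathcal{BA}$ is the subvariety of $\mathcal I$ defined by $(x\to y)\to x \approx x$ and $x \to x \approx 0'$. *)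

theory Defs
  imports Main
begin

datatype trm = Var nat | Zero | Arrow trm trm  (infixr "\<rightarrow>" 65)

abbreviation X :: trm where "X \<equiv> Var 0"
abbreviation Y :: trm where "Y \<equiv> Var 1"
abbreviation Z :: trm where "Z \<equiv> Var 2"

abbreviation prime_trm :: "trm \<Rightarrow> trm"  ("_\<acute>" [1000] 1000)
  where "t\<acute> \<equiv> t \<rightarrow> Zero"

abbreviation meet_trm :: "trm \<Rightarrow> trm \<Rightarrow> trm"  (infixl "\<sqinter>\<^sub>t" 70)
  where "s \<sqinter>\<^sub>t t \<equiv> (s \<rightarrow> t\<acute>)\<acute>"

type_synonym identity = "trm \<times> trm"

abbreviation (input) identity_of :: "trm \<Rightarrow> trm \<Rightarrow> identity"  (infix "\<approx>" 50)
  where "s \<approx> t \<equiv> (s, t)"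

record 'a zroupoid =
  univ :: "'a set"
  arrow :: "'a \<Rightarrow> 'a \<Rightarrow> 'a"
  zero_elem :: 'a

definition is_algebra :: "'a zroupoid \<Rightarrow> bool" where
  "is_algebra A \<longleftrightarrow>
     zero_elem A \<in> univ A \<and> (\<forall>a\<in>univ A. \<forall>b\<in>univ A. arrow A a b \<in> univ A)"

primrec eval_trm :: "'a zroupoid \<Rightarrow> (nat \<Rightarrow> 'a) \<Rightarrow> trm \<Rightarrow> 'a" where
  "eval_trm A v (Var n) = v n"
| "eval_trm A v Zero = zero_elem A"
| "eval_trm A v (s \<rightarrow> t) = arrow A (eval_trm A v s) (eval_trm A v t)"

definition satisfies :: "'a zroupoid \<Rightarrow> identity \<Rightarrow> bool" where
  "satisfies A e \<longleftrightarrow>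
     (\<forall>v. range v \<subseteq> univ A \<longrightarrow> eval_trm A v (fst e) = eval_trm A v (snd e))"

text \<open>
  HOL has no class of all algebras, so a variety is represented by the set of its members
  whose carrier is a subset of an ambient type \<^typ>\<open>'a\<close>. When \<^typ>\<open>'a\<close> is infinite nothing
  is lost: two varieties in a countable language coincide as soon as they have the same
  countable members, and every countable algebra has a copy carried by a subset of \<^typ>\<open>'a\<close>.
  On too small a type, different varieties can have the same members.
\<close>

definition variety :: "identity set \<Rightarrow> 'a zroupoid set" where
  "variety E = {A. is_algebra A \<and> (\<forall>e\<in>E. satisfies A e)}"

definition I_identities :: "identity set" where
  "I_identities =
     {(X \<rightarrow> Y) \<rightarrow> Z \<approx> ((Z\<acute> \<rightarrow> X) \<rightarrow> (Y \<rightarrow> Z)\<acute>)\<acute>,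
      Zero\<acute>\<acute> \<approx> Zero}"

definition I_zroupoids :: "'a zroupoid set" where
  "I_zroupoids = variety I_identities"

definition symmetric_I_zroupoids :: "'a zroupoid set" where
  "symmetric_I_zroupoids =
     variety (I_identities \<union> {X\<acute>\<acute> \<approx> X, X \<sqinter>\<^sub>t Y \<approx> Y \<sqinter>\<^sub>t X})"

definition SL :: "'a zroupoid set" where
  "SL = variety (I_identities \<union> {X\<acute> \<approx> X, X \<rightarrow> Y \<approx> Y \<rightarrow> X})"

definition BA :: "'a zroupoid set" where
  "BA = variety (I_identities \<union> {(X \<rightarrow> Y) \<rightarrow> X \<approx> X, X \<rightarrow> X \<approx> Zero\<acute>})"

text \<open>The identities are numbered from 1, list positions from 0.\<close>

definition A_identities :: "identity list" where
  "A_identities =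
    [X \<rightarrow> (Y \<rightarrow> Z) \<approx> (X \<rightarrow> Y) \<rightarrow> Z,
     X \<rightarrow> (Y \<rightarrow> Z) \<approx> X \<rightarrow> (Z \<rightarrow> Y),
     X \<rightarrow> (Y \<rightarrow> Z) \<approx> (X \<rightarrow> Z) \<rightarrow> Y,
     X \<rightarrow> (Y \<rightarrow> Z) \<approx> Y \<rightarrow> (X \<rightarrow> Z),
     X \<rightarrow> (Y \<rightarrow> Z) \<approx> (Y \<rightarrow> X) \<rightarrow> Z,
     X \<rightarrow> (Y \<rightarrow> Z) \<approx> Y \<rightarrow> (Z \<rightarrow> X),
     X \<rightarrow> (Y \<rightarrow> Z) \<approx> (Y \<rightarrow> Z) \<rightarrow> X,
     X \<rightarrow> (Y \<rightarrow> Z) \<approx> (Z \<rightarrow> X) \<rightarrow> Y,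
     X \<rightarrow> (Y \<rightarrow> Z) \<approx> Z \<rightarrow> (Y \<rightarrow> X),
     X \<rightarrow> (Y \<rightarrow> Z) \<approx> (Z \<rightarrow> Y) \<rightarrow> X,
     (X \<rightarrow> Y) \<rightarrow> Z \<approx> (X \<rightarrow> Z) \<rightarrow> Y,
     (X \<rightarrow> Y) \<rightarrow> Z \<approx> (Y \<rightarrow> X) \<rightarrow> Z,
     (X \<rightarrow> Y) \<rightarrow> Z \<approx> (Y \<rightarrow> Z) \<rightarrow> X,
     (X \<rightarrow> Y) \<rightarrow> Z \<approx> (Z \<rightarrow> Y) \<rightarrow> X]"

definition A_identity :: "nat \<Rightarrow> identity" where
  "A_identity i = A_identities ! (i - 1)"

definition A_variety :: "nat \<Rightarrow> 'a zroupoid set" where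
  "A_variety i = variety (I_identities \<union> {A_identity i})"

definition S_variety :: "nat \<Rightarrow> 'a zroupoid set" where
  "S_variety i = A_variety i \<inter> symmetric_I_zroupoids"

definition assoc_words :: "trm set" where
  "assoc_words =
     {u \<rightarrow> (v \<rightarrow> w) | u v w. {u, v, w} = {X, Y, Z}} \<union>
     {(u \<rightarrow> v) \<rightarrow> w | u v w. {u, v, w} = {X, Y, Z}}"

definition assoc_type_subvarieties :: "'a zroupoid set set" where
  "assoc_type_subvarieties =
     {{A \<in> symmetric_I_zroupoids. satisfies A (p \<approx> q)} | p q.
        p \<in> assoc_words \<and> q \<in> assoc_words}"

end

theory Submission
  imports Defs
begin

text \<open>With \<open>x \<squnion> y = x' \<rightarrow> y\<close>, \<open>x \<sqinter> y = (x \<rightarrow> y')'\<close> and \<open>1 = 0'\<close>, the defining identity of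
  symmetric \<open>\<I>\<close>-zroupoids says that \<open>\<squnion>\<close> and \<open>\<sqinter>\<close> are commutative De Morgan duals which distribute
  over each other and have units \<open>0\<close> and \<open>1\<close>; absorption may fail. Still, \<open>\<squnion>\<close> is associative:
  the elements \<open>0 \<sqinter> x\<close> act on the algebra by \<open>\<squnion>\<close> as a semilattice and record the defect of absorption,
  \<open>x \<sqinter> (x \<squnion> y) = (0 \<sqinter> y) \<squnion> x\<close>, so both bracketings of a triple join have the same meets with
  each of the three elements, hence with each other. Consequently (A4) always holds. Substituting \<open>0\<close>
  and \<open>1\<close> in each of the other identities except (A14) gives \<open>x' = x\<close>, that is, a semilattice.\<close>


section \<open>Two mutually distributive operations with units: associativity of the join\<close>

locale bidistributive =
  fixes U :: "'a set"
    and join :: "'a \<Rightarrow> 'a \<Rightarrow> 'a"  (infixl "\<squnion>" 65)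
    and meet :: "'a \<Rightarrow> 'a \<Rightarrow> 'a"  (infixl "\<sqinter>" 70)
    and zero :: 'a  ("\<zero>")
    and one :: 'a  ("\<one>")
  assumes join_closed [simp]: "\<lbrakk>x \<in> U; y \<in> U\<rbrakk> \<Longrightarrow> x \<squnion> y \<in> U"
    and meet_closed [simp]: "\<lbrakk>x \<in> U; y \<in> U\<rbrakk> \<Longrightarrow> x \<sqinter> y \<in> U"
    and zero_closed [simp]: "\<zero> \<in> U"
    and one_closed [simp]: "\<one> \<in> U"
    and join_comm: "\<lbrakk>x \<in> U; y \<in> U\<rbrakk> \<Longrightarrow> x \<squnion> y = y \<squnion> x"
    and meet_comm: "\<lbrakk>x \<in> U; y \<in> U\<rbrakk> \<Longrightarrow> x \<sqinter> y = y \<sqinter> x"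
    and join_zero [simp]: "x \<in> U \<Longrightarrow> x \<squnion> \<zero> = x"
    and meet_one [simp]: "x \<in> U \<Longrightarrow> x \<sqinter> \<one> = x"
    and join_distrib: "\<lbrakk>x \<in> U; y \<in> U; w \<in> U\<rbrakk> \<Longrightarrow> x \<sqinter> y \<squnion> w = (x \<squnion> w) \<sqinter> (y \<squnion> w)"
    and meet_distrib: "\<lbrakk>x \<in> U; y \<in> U; w \<in> U\<rbrakk> \<Longrightarrow> (x \<squnion> y) \<sqinter> w = x \<sqinter> w \<squnion> y \<sqinter> w"
begin

lemmas closed = join_closed meet_closed zero_closed one_closed

text \<open>The axioms are self-dual, so interpreting the locale with the operations and the units
  exchanged yields the dual of every fact proved so far.\<close>

lemma dual: "bidistributive U (\<sqinter>) (\<squnion>) \<one> \<zero>"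
  by unfold_locales (auto intro: join_comm meet_comm join_distrib meet_distrib)

text \<open>Distribute in \<open>x = (\<one> \<squnion> \<zero>) \<sqinter> x\<close>.\<close>

lemma join_zero_meet [simp]: "x \<in> U \<Longrightarrow> x \<squnion> \<zero> \<sqinter> x = x"
  by (metis join_zero meet_one meet_distrib join_comm meet_comm closed)

lemma one_join_one: "\<one> \<squnion> \<one> = \<one>"
proof -
  interpret dual: bidistributive U "(\<sqinter>)" "(\<squnion>)" \<one> \<zero> by (rule dual)
  show ?thesis
    using dual.join_zero_meet[of \<one>] meet_comm[of \<one> "\<one> \<squnion> \<one>"] by simp
qed

lemma join_idem [simp]: "x \<in> U \<Longrightarrow> x \<squnion> x = x"
  by (metis one_join_one meet_distrib meet_comm meet_one one_closed)

lemma meet_idem [simp]: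
  assumes "x \<in> U"
  shows "x \<sqinter> x = x"
proof -
  interpret dual: bidistributive U "(\<sqinter>)" "(\<squnion>)" \<one> \<zero> by (rule dual)
  show ?thesis using assms by (rule dual.join_idem)
qed

lemma zero_meet_join: "\<lbrakk>x \<in> U; y \<in> U\<rbrakk> \<Longrightarrow> \<zero> \<sqinter> x \<squnion> y = y \<sqinter> (x \<squnion> y)"
  by (metis join_distrib join_comm join_zero zero_closed)

lemma join_meet: "\<lbrakk>x \<in> U; y \<in> U\<rbrakk> \<Longrightarrow> y \<sqinter> (x \<squnion> y) = y \<squnion> x \<sqinter> y"
  by (metis join_comm join_distrib join_idem meet_comm meet_closed)

text \<open>Both sides are absorption terms: the left is
  \<open>y \<sqinter> (x \<squnion> y)\<close>, the right, dually, is
  \<open>y \<squnion> x \<sqinter> y\<close>, and \<open>join_meet\<close> identifies the two. Hence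
  joining with \<open>\<zero> \<sqinter> x\<close> is the same as meeting with
  \<open>\<one> \<squnion> x\<close>, so that such a join distributes like a meet.\<close>

lemma zero_meet_join_eq:
  assumes "x \<in> U" "y \<in> U"
  shows "\<zero> \<sqinter> x \<squnion> y = (\<one> \<squnion> x) \<sqinter> y"
proof -
  interpret dual: bidistributive U "(\<sqinter>)" "(\<squnion>)" \<one> \<zero> by (rule dual)
  show ?thesis
    using assms zero_meet_join[of x y] join_meet[of x y] dual.zero_meet_join[of x y] by simp
qed

text \<open>The case \<open>y = \<zero>\<close> of \<open>zero_meet_join_eq\<close>; the next lemma
  is the case \<open>y = \<one>\<close>. Together they show that \<open>\<zero> \<sqinter> x\<close>
  and \<open>\<one> \<squnion> x\<close> determine each other.\<close>

lemma zero_meet_one_join: "x \<in> U \<Longrightarrow> \<zero> \<sqinter> (\<one> \<squnion> x) = \<zero> \<sqinter> x"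
  by (metis zero_meet_join_eq join_zero meet_comm closed)

lemma one_join_zero_meet: "x \<in> U \<Longrightarrow> \<one> \<squnion> \<zero> \<sqinter> x = \<one> \<squnion> x"
  by (metis zero_meet_join_eq meet_one join_comm closed)

lemma zero_meet_zero_meet: "x \<in> U \<Longrightarrow> \<zero> \<sqinter> (\<zero> \<sqinter> x) = \<zero> \<sqinter> x"
  by (metis one_join_zero_meet zero_meet_one_join meet_closed zero_closed)

lemma zero_meet_distrib:
  "\<lbrakk>x \<in> U; y \<in> U\<rbrakk> \<Longrightarrow> \<zero> \<sqinter> (x \<squnion> y) = \<zero> \<sqinter> x \<squnion> \<zero> \<sqinter> y"
  by (metis meet_comm meet_distrib closed)

text \<open>A join already contains the defects of its arguments: as a meet with
  \<open>\<one> \<squnion> x\<close>, the left side collapses by distributivity.\<close>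

lemma zero_meet_join_absorb:
  assumes "x \<in> U" "y \<in> U"
  shows "\<zero> \<sqinter> x \<squnion> (y \<squnion> x) = y \<squnion> x"
proof -
  have "\<zero> \<sqinter> x \<squnion> (y \<squnion> x) = (\<one> \<squnion> x) \<sqinter> (y \<squnion> x)"
    using assms by (simp add: zero_meet_join_eq)
  also have "\<dots> = \<one> \<sqinter> y \<squnion> x"
    using assms by (simp add: join_distrib)
  also have "\<dots> = y \<squnion> x"
    using assms by (metis meet_comm meet_one one_closed)
  finally show ?thesis .
qed

text \<open>On top of \<open>\<one> \<squnion> x\<close>, an element acts only through its defect.
  Joining the defect of \<open>y\<close> gives an absorption term, which turns into a join of
  \<open>\<zero> \<sqinter> x\<close> with something that already contains it.\<close>

lemma one_join_join:
  assumes "x \<in> U" "y \<in> U"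
  shows "(\<one> \<squnion> x) \<squnion> y = (\<one> \<squnion> x) \<squnion> \<zero> \<sqinter> y"
proof -
  let ?s = "\<one> \<squnion> x"
  have "?s \<squnion> \<zero> \<sqinter> y = \<zero> \<sqinter> y \<squnion> ?s"
    using assms by (simp add: join_comm)
  also have "\<dots> = ?s \<sqinter> (y \<squnion> ?s)"
    using assms zero_meet_join[of y ?s] by simp
  also have "\<dots> = \<zero> \<sqinter> x \<squnion> (y \<squnion> ?s)"
    using assms by (simp add: zero_meet_join_eq)
  also have "\<dots> = y \<squnion> ?s"
    using assms zero_meet_join_absorb[of ?s y] by (simp add: zero_meet_one_join)
  finally show ?thesis
    using assms by (simp add: join_comm)
qed

text \<open>Associativity when the first argument is a defect. Read as a meet with
  \<open>\<one> \<squnion> y\<close>, the inner join distributes over \<open>q\<close>; there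
  \<open>q\<close> may be replaced by \<open>\<zero> \<sqinter> q\<close>, which after meeting with
  \<open>p \<squnion> q\<close> becomes the defect of \<open>p \<squnion> q\<close>, and the same
  rewriting is then undone for \<open>p \<squnion> q\<close>.\<close>

lemma zero_meet_join_assoc:
  assumes "y \<in> U" "p \<in> U" "q \<in> U"
  shows "(\<zero> \<sqinter> y \<squnion> p) \<squnion> q = \<zero> \<sqinter> y \<squnion> (p \<squnion> q)"
proof -
  interpret dual: bidistributive U "(\<sqinter>)" "(\<squnion>)" \<one> \<zero> by (rule dual)
  let ?s = "\<one> \<squnion> y" and ?r = "p \<squnion> q"
  have s_join: "(?s \<squnion> w) \<sqinter> w = ?s \<sqinter> w" if "w \<in> U" for w
    using assms that zero_meet_join[of ?s w]
    by (simp add: zero_meet_one_join zero_meet_join_eq meet_comm[of "?s \<squnion> w" w])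
  \<comment> \<open>Dually to \<open>one_join_join\<close>, \<open>?r\<close> may be replaced by
    \<open>\<one> \<squnion> ?r\<close> under a meet with \<open>\<zero> \<sqinter> q\<close>. The
    result is the join of two defects, of which that of \<open>?r\<close> already contains that of
    \<open>q\<close>.\<close>
  have zero_q: "(\<zero> \<sqinter> q) \<sqinter> ?r = \<zero> \<sqinter> ?r"
  proof -
    have "(\<zero> \<sqinter> q) \<sqinter> ?r = (\<one> \<squnion> ?r) \<sqinter> (\<zero> \<sqinter> q)"
      using assms dual.one_join_join[of q ?r] by (simp add: meet_comm)
    also have "\<dots> = \<zero> \<sqinter> ?r \<squnion> \<zero> \<sqinter> q"
      using assms by (simp add: zero_meet_join_eq)
    also have "\<dots> = \<zero> \<sqinter> ?r"
      using assms zero_meet_join_absorb[of "\<zero> \<sqinter> q" "\<zero> \<sqinter> p"]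
      by (simp add: zero_meet_distrib zero_meet_zero_meet join_comm)
    finally show ?thesis .
  qed
  have "(\<zero> \<sqinter> y \<squnion> p) \<squnion> q = ?s \<sqinter> p \<squnion> q"
    using assms by (simp add: zero_meet_join_eq)
  also have "\<dots> = (?s \<squnion> q) \<sqinter> ?r"
    using assms by (simp add: join_distrib)
  also have "\<dots> = (?s \<squnion> \<zero> \<sqinter> q) \<sqinter> ?r"
    using assms by (simp add: one_join_join[of y q])
  also have "\<dots> = ?s \<sqinter> ?r \<squnion> \<zero> \<sqinter> ?r"
    using assms by (simp add: meet_distrib zero_q)
  also have "\<dots> = (?s \<squnion> \<zero> \<sqinter> ?r) \<sqinter> ?r"
    using assms by (simp add: join_distrib)
  also have "\<dots> = (?s \<squnion> ?r) \<sqinter> ?r"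
    using assms by (simp add: one_join_join[of y ?r])
  also have "\<dots> = \<zero> \<sqinter> y \<squnion> ?r"
    using assms by (simp add: s_join zero_meet_join_eq)
  finally show ?thesis .
qed

lemma zero_meet_join_distrib:
  assumes "x \<in> U" "y \<in> U" "w \<in> U"
  shows "\<zero> \<sqinter> (x \<squnion> y) \<squnion> w = \<zero> \<sqinter> x \<squnion> (\<zero> \<sqinter> y \<squnion> w)"
  using assms by (simp add: zero_meet_distrib zero_meet_join_assoc)

text \<open>Both sides equal \<open>\<zero> \<sqinter> (x \<squnion> y) \<squnion> w\<close>, whose
  first argument is symmetric in \<open>x\<close> and \<open>y\<close>.\<close>

lemma zero_meet_left_commute:
  assumes "x \<in> U" "y \<in> U" "w \<in> U"
  shows "\<zero> \<sqinter> x \<squnion> (\<zero> \<sqinter> y \<squnion> w) = \<zero> \<sqinter> y \<squnion> (\<zero> \<sqinter> x \<squnion> w)"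
  using assms by (metis zero_meet_join_distrib join_comm)

lemma meet_join_join:
  assumes "x \<in> U" "y \<in> U" "w \<in> U"
  shows "x \<sqinter> (x \<squnion> (y \<squnion> w)) = \<zero> \<sqinter> y \<squnion> (\<zero> \<sqinter> w \<squnion> x)"
proof -
  have "x \<sqinter> (x \<squnion> (y \<squnion> w)) = \<zero> \<sqinter> (y \<squnion> w) \<squnion> x"
    using assms by (metis zero_meet_join join_comm join_closed)
  then show ?thesis
    using assms by (simp add: zero_meet_join_distrib)
qed

lemma meet_join_join_left:
  assumes "x \<in> U" "y \<in> U" "w \<in> U"
  shows "x \<sqinter> ((x \<squnion> y) \<squnion> w) = \<zero> \<sqinter> y \<squnion> (\<zero> \<sqinter> w \<squnion> x)"
proof -
  have "x \<sqinter> ((x \<squnion> y) \<squnion> w) = x \<sqinter> (x \<squnion> y) \<squnion> x \<sqinter> w"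
    using assms by (metis meet_distrib meet_comm closed)
  also have "\<dots> = (\<zero> \<sqinter> y \<squnion> x) \<squnion> x \<sqinter> w"
    using assms by (metis zero_meet_join join_comm)
  also have "\<dots> = \<zero> \<sqinter> y \<squnion> (x \<squnion> x \<sqinter> w)"
    using assms by (simp add: zero_meet_join_assoc)
  \<comment> \<open>The two forms of absorption agree, so this join also only adds the defect of
    \<open>w\<close> to \<open>x\<close>.\<close>
  also have "x \<squnion> x \<sqinter> w = \<zero> \<sqinter> w \<squnion> x"
    using assms by (metis join_meet zero_meet_join meet_comm)
  finally show ?thesis .
qed

lemma join_assoc:
  assumes "x \<in> U" "y \<in> U" "w \<in> U"
  shows "(x \<squnion> y) \<squnion> w = x \<squnion> (y \<squnion> w)"
proof -
  let ?a = "(x \<squnion> y) \<squnion> w" and ?b = "x \<squnion> (y \<squnion> w)"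
  have x: "x \<sqinter> ?a = x \<sqinter> ?b"
    using assms by (simp add: meet_join_join meet_join_join_left)
  \<comment> \<open>Once \<open>y\<close> is in front, its meet with the triple join is
    \<open>y\<close> with two defects added; these commute, so \<open>x\<close> and \<open>w\<close>
    may change places.\<close>
  have "y \<sqinter> ?a = y \<sqinter> ((y \<squnion> x) \<squnion> w)"
    using assms by (simp add: join_comm[of x y])
  also have "\<dots> = y \<sqinter> ((y \<squnion> w) \<squnion> x)"
    using assms by (simp add: meet_join_join_left zero_meet_left_commute)
  also have "\<dots> = y \<sqinter> ?b"
    using assms by (simp add: join_comm[of x "y \<squnion> w"])
  finally have y: "y \<sqinter> ?a = y \<sqinter> ?b" .
  have "w \<sqinter> ?a = w \<sqinter> (w \<squnion> (x \<squnion> y))"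
    using assms by (simp add: join_comm[of w])
  also have "\<dots> = w \<sqinter> ((w \<squnion> y) \<squnion> x)"
    using assms by (simp add: meet_join_join meet_join_join_left zero_meet_left_commute)
  also have "\<dots> = w \<sqinter> ?b"
    using assms by (simp add: join_comm[of x] join_comm[of w y])
  finally have w: "w \<sqinter> ?a = w \<sqinter> ?b" .
  \<comment> \<open>Distributing one copy of \<open>?b\<close> reduces everything to meets with
    single elements, where \<open>?a\<close> may replace \<open>?b\<close>; collecting again gives
    \<open>?b \<sqinter> ?a\<close>. The same for \<open>?a\<close> gives
    \<open>?a \<sqinter> ?b\<close>.\<close>
  have "?b = ?b \<sqinter> ?b"
    using assms by simp
  also have "\<dots> = x \<sqinter> ?b \<squnion> (y \<sqinter> ?b \<squnion> w \<sqinter> ?b)"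
    using assms by (simp add: meet_distrib[where w = ?b] del: meet_idem)
  also have "\<dots> = x \<sqinter> ?a \<squnion> (y \<sqinter> ?a \<squnion> w \<sqinter> ?a)"
    using assms by (simp only: x y w)
  also have "\<dots> = ?b \<sqinter> ?a"
    using assms by (simp add: meet_distrib)
  finally have b: "?b = ?b \<sqinter> ?a" .
  have "?a = ?a \<sqinter> ?a"
    using assms by simp
  also have "\<dots> = (x \<sqinter> ?a \<squnion> y \<sqinter> ?a) \<squnion> w \<sqinter> ?a"
    using assms by (simp add: meet_distrib[where w = ?a] del: meet_idem)
  also have "\<dots> = (x \<sqinter> ?b \<squnion> y \<sqinter> ?b) \<squnion> w \<sqinter> ?b"
    using assms by (simp only: x y w)
  also have "\<dots> = ?a \<sqinter> ?b"
    using assms by (simp add: meet_distrib)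
  finally show ?thesis
    using assms b by (simp add: meet_comm)
qed

end

section \<open>Symmetric zroupoids as bidistributive algebras\<close>

locale symmetric_zroupoid =
  fixes U :: "'a set"
    and arr :: "'a \<Rightarrow> 'a \<Rightarrow> 'a"  (infixr "\<rightharpoonup>" 65)
    and zero :: 'a  ("\<zero>")
  assumes arr_closed [simp]: "\<lbrakk>x \<in> U; y \<in> U\<rbrakk> \<Longrightarrow> x \<rightharpoonup> y \<in> U"
    and zero_closed [simp]: "\<zero> \<in> U"
    and arr_arr: "\<lbrakk>x \<in> U; y \<in> U; w \<in> U\<rbrakk> \<Longrightarrow>
      (x \<rightharpoonup> y) \<rightharpoonup> w = (((w \<rightharpoonup> \<zero>) \<rightharpoonup> x) \<rightharpoonup> (y \<rightharpoonup> w) \<rightharpoonup> \<zero>) \<rightharpoonup> \<zero>"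
    and prime_prime [simp]: "x \<in> U \<Longrightarrow> (x \<rightharpoonup> \<zero>) \<rightharpoonup> \<zero> = x"
    and prime_comm: "\<lbrakk>x \<in> U; y \<in> U\<rbrakk> \<Longrightarrow>
      (x \<rightharpoonup> y \<rightharpoonup> \<zero>) \<rightharpoonup> \<zero> = (y \<rightharpoonup> x \<rightharpoonup> \<zero>) \<rightharpoonup> \<zero>"
begin

abbreviation one :: 'a  ("\<one>") where "\<one> \<equiv> \<zero> \<rightharpoonup> \<zero>"

lemma arr_prime: "\<lbrakk>x \<in> U; y \<in> U\<rbrakk> \<Longrightarrow> x \<rightharpoonup> y \<rightharpoonup> \<zero> = y \<rightharpoonup> x \<rightharpoonup> \<zero>"
  by (metis prime_comm prime_prime arr_closed zero_closed)

lemma contraposition: "\<lbrakk>x \<in> U; y \<in> U\<rbrakk> \<Longrightarrow> (x \<rightharpoonup> \<zero>) \<rightharpoonup> y \<rightharpoonup> \<zero> = y \<rightharpoonup> x"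
  by (metis arr_prime prime_prime arr_closed zero_closed)

lemma one_arr [simp]: "x \<in> U \<Longrightarrow> \<one> \<rightharpoonup> x = x"
  by (metis contraposition prime_prime arr_closed zero_closed)

definition join (infixl "\<squnion>" 65) where "x \<squnion> y = (x \<rightharpoonup> \<zero>) \<rightharpoonup> y"
definition meet (infixl "\<sqinter>" 70) where "x \<sqinter> y = (x \<rightharpoonup> y \<rightharpoonup> \<zero>) \<rightharpoonup> \<zero>"

sublocale bidistributive U join meet \<zero> \<one>
proof unfold_locales
  \<comment> \<open>This is \<open>arr_arr\<close> with the prime of \<open>y\<close> in place of
    \<open>y\<close>; contraposition turns
    \<open>(w \<rightharpoonup> \<zero>) \<rightharpoonup> x\<close> into
    \<open>(x \<rightharpoonup> \<zero>) \<rightharpoonup> w\<close>.\<close>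
  show join_distrib: "x \<sqinter> y \<squnion> w = (x \<squnion> w) \<sqinter> (y \<squnion> w)" if "x \<in> U" "y \<in> U" "w \<in> U" for x y w
    using that arr_arr[of x "y \<rightharpoonup> \<zero>" w] contraposition[of x "w \<rightharpoonup> \<zero>"]
    by (simp add: join_def meet_def)
  have de_morgan: "(x \<squnion> y) \<sqinter> w = (((x \<rightharpoonup> \<zero>) \<sqinter> (y \<rightharpoonup> \<zero>)) \<squnion> (w \<rightharpoonup> \<zero>)) \<rightharpoonup> \<zero>"
      "x \<sqinter> w \<squnion> y \<sqinter> w = (((x \<rightharpoonup> \<zero>) \<squnion> (w \<rightharpoonup> \<zero>)) \<sqinter> ((y \<rightharpoonup> \<zero>) \<squnion> (w \<rightharpoonup> \<zero>))) \<rightharpoonup> \<zero>"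
    if "x \<in> U" "y \<in> U" "w \<in> U" for x y w
    using that by (simp_all add: join_def meet_def)
  show "(x \<squnion> y) \<sqinter> w = x \<sqinter> w \<squnion> y \<sqinter> w" if "x \<in> U" "y \<in> U" "w \<in> U" for x y w
    using that by (simp add: de_morgan join_distrib)
  show "x \<squnion> y = y \<squnion> x" if "x \<in> U" "y \<in> U" for x y
    using that contraposition[of y "x \<rightharpoonup> \<zero>"] by (simp add: join_def)
qed (auto simp: join_def meet_def intro: prime_comm)

lemma zero_arr_one [simp]: "\<zero> \<rightharpoonup> \<one> = \<one>"
  using join_idem[of \<one>] by (simp add: join_def)

text \<open>With \<open>x\<close> and \<open>y\<close> primed, both sides are triple joins, so this
  is associativity and commutativity of the join.\<close>

lemma arr_left_commute: "\<lbrakk>x \<in> U; y \<in> U; w \<in> U\<rbrakk> \<Longrightarrow> x \<rightharpoonup> y \<rightharpoonup> w = y \<rightharpoonup> x \<rightharpoonup> w"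
  using join_assoc[of "x \<rightharpoonup> \<zero>" "y \<rightharpoonup> \<zero>" w] join_assoc[of "y \<rightharpoonup> \<zero>" "x \<rightharpoonup> \<zero>" w] join_comm[of "x \<rightharpoonup> \<zero>" "y \<rightharpoonup> \<zero>"]
  by (simp add: join_def)

end

section \<open>From identities between terms to equations between elements\<close>

primrec vars_trm :: "trm \<Rightarrow> nat set" where
  "vars_trm (Var n) = {n}"
| "vars_trm Zero = {}"
| "vars_trm (Arrow s t) = vars_trm s \<union> vars_trm t"

lemma eval_trm_cong: "(\<And>n. n \<in> vars_trm t \<Longrightarrow> v n = w n) \<Longrightarrow> eval_trm A v t = eval_trm A w t"
  by (induction t) auto

lemma eval_trm_closed: "\<lbrakk>is_algebra A; range v \<subseteq> univ A\<rbrakk> \<Longrightarrow> eval_trm A v t \<in> univ A"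
  by (induction t) (auto simp: is_algebra_def)

text \<open>The indices \<open>a\<close>, \<open>b\<close>, \<open>c\<close> are arbitrary so that
  an identity and a renamed copy of it unfold to the same quantified equation. Every index other
  than \<open>a\<close> and \<open>b\<close> receives the value of \<open>c\<close>.\<close>

lemma satisfies_ternary:
  assumes "a \<noteq> b" "a \<noteq> c" "b \<noteq> c" and vars: "vars_trm p \<union> vars_trm q \<subseteq> {a, b, c}"
  shows "satisfies A (p, q) \<longleftrightarrow> (\<forall>x\<in>univ A. \<forall>y\<in>univ A. \<forall>z\<in>univ A.
    eval_trm A ((\<lambda>_. z)(a := x, b := y)) p = eval_trm A ((\<lambda>_. z)(a := x, b := y)) q)"
    (is "_ \<longleftrightarrow> ?R")
proof
  assume "satisfies A (p, q)"
  then show ?R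
    by (auto simp: satisfies_def image_subset_iff)
next
  assume R: ?R
  show "satisfies A (p, q)"
    unfolding satisfies_def fst_conv snd_conv
  proof (intro allI impI)
    fix v :: "nat \<Rightarrow> 'a"
    assume v: "range v \<subseteq> univ A"
    let ?w = "(\<lambda>_. v c)(a := v a, b := v b)"
    have "eval_trm A v p = eval_trm A ?w p" "eval_trm A v q = eval_trm A ?w q"
      using vars by (auto intro!: eval_trm_cong)
    moreover have "eval_trm A ?w p = eval_trm A ?w q"
      using R v by blast
    ultimately show "eval_trm A v p = eval_trm A v q"
      by simp
  qed
qed

lemmas satisfies_XYZ = satisfies_ternary[of 0 "Suc 0" 2, simplified]

lemma satisfies_XYZ_D:
  assumes "satisfies A e" "x \<in> univ A" "y \<in> univ A" "z \<in> univ A"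
  shows "eval_trm A ((\<lambda>_. z)(0 := x, 1 := y)) (fst e) =
    eval_trm A ((\<lambda>_. z)(0 := x, 1 := y)) (snd e)"
  using assms by (auto simp: satisfies_def image_subset_iff)

lemma symmetric_zroupoid:
  assumes "A \<in> symmetric_I_zroupoids"
  shows "symmetric_zroupoid (univ A) (arrow A) (zero_elem A)"
proof -
  have alg: "is_algebra A"
    and I: "satisfies A ((X \<rightarrow> Y) \<rightarrow> Z, ((Z\<acute> \<rightarrow> X) \<rightarrow> (Y \<rightarrow> Z)\<acute>)\<acute>)"
    and pp: "satisfies A (X\<acute>\<acute>, X)"
    and comm: "satisfies A (X \<sqinter>\<^sub>t Y, Y \<sqinter>\<^sub>t X)"
    using assms by (simp_all add: symmetric_I_zroupoids_def variety_def I_identities_def)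
  show ?thesis
  proof unfold_locales
    fix x y w
    assume "x \<in> univ A" "y \<in> univ A" "w \<in> univ A"
    from satisfies_XYZ_D[OF I this]
    show "arrow A (arrow A x y) w =
      arrow A (arrow A (arrow A (arrow A w (zero_elem A)) x) (arrow A (arrow A y w) (zero_elem A)))
        (zero_elem A)"
      by simp
  next
    fix x
    assume "x \<in> univ A"
    from satisfies_XYZ_D[OF pp this this this]
    show "arrow A (arrow A x (zero_elem A)) (zero_elem A) = x"
      by simp
  next
    fix x y
    assume "x \<in> univ A" "y \<in> univ A"
    from satisfies_XYZ_D[OF comm this this(2)]
    show "arrow A (arrow A x (arrow A y (zero_elem A))) (zero_elem A) =
      arrow A (arrow A y (arrow A x (zero_elem A))) (zero_elem A)"
      by simp
  qed (use alg in \<open>auto simp: is_algebra_def\<close>)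
qed

section \<open>Semilattices inside the symmetric zroupoids\<close>

lemma SL_D:
  assumes "A \<in> SL" "x \<in> univ A" "y \<in> univ A"
  shows "arrow A x (zero_elem A) = x" "arrow A x y = arrow A y x"
proof -
  have "satisfies A (X\<acute>, X)" "satisfies A (X \<rightarrow> Y, Y \<rightarrow> X)"
    using assms(1) by (simp_all add: SL_def variety_def)
  from this[THEN satisfies_XYZ_D, OF assms(2,3,3)]
  show "arrow A x (zero_elem A) = x" "arrow A x y = arrow A y x"
    by simp_all
qed

text \<open>When prime is the identity map, the meet is the arrow itself, which is
  commutative.\<close>

lemma SL_subset: "SL \<subseteq> symmetric_I_zroupoids"
proof
  fix A :: "'a zroupoid"
  assume A: "A \<in> SL"
  then have alg: "is_algebra A"
    by (simp add: SL_def variety_def)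
  show "A \<in> symmetric_I_zroupoids"
    using A alg SL_D[OF A]
    by (auto simp: SL_def symmetric_I_zroupoids_def variety_def satisfies_XYZ is_algebra_def)
qed

text \<open>Contraposition becomes commutativity once prime is the identity map.\<close>

lemma symmetric_in_SL:
  assumes "A \<in> symmetric_I_zroupoids" and "\<And>x. x \<in> univ A \<Longrightarrow> arrow A x (zero_elem A) = x"
  shows "A \<in> SL"
proof -
  interpret symmetric_zroupoid "univ A" "arrow A" "zero_elem A"
    using assms(1) by (rule symmetric_zroupoid)
  have "arrow A x y = arrow A y x" if "x \<in> univ A" "y \<in> univ A" for x y
    using that contraposition[of x y] assms(2) by simp
  then show ?thesis
    using assms by (auto simp: SL_def symmetric_I_zroupoids_def variety_def satisfies_XYZ)
qed

text \<open>Setting one variable to \<open>\<one>\<close> makes the arrow commutative under (A2),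
  (A6), (A7), (A9), (A11). Under (A1), (A3), (A8), (A10), (A13), setting two variables to
  \<open>\<zero>\<close> or two to \<open>\<one>\<close> gives
  \<open>x \<rightharpoonup> \<one> = x\<close>. As
  \<open>\<zero> \<rightharpoonup> \<one> = \<one>\<close>, either forces
  \<open>\<zero> = \<one>\<close>, and then prime is the identity map. (A5) and (A12) also force
  \<open>\<zero> = \<one>\<close>, and a further substitution of \<open>\<zero>\<close>
  finishes.\<close>

lemma in_SL_if_satisfies_A_identity:
  assumes A: "A \<in> symmetric_I_zroupoids" and sat: "satisfies A (A_identity i)"
    and i: "i \<in> {1..14} - {4, 14}"
  shows "A \<in> SL"
proof (rule symmetric_in_SL[OF A])
  interpret symmetric_zroupoid "univ A" "arrow A" "zero_elem A"
    using A by (rule symmetric_zroupoid)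
  fix x
  assume x: "x \<in> univ A"
  have "i \<in> {1, 2, 3, 5, 6, 7, 8, 9, 10, 11, 12, 13}"
    using i by simp presburger
  \<comment> \<open>The cases below are numbered by position in this list: from the fourth on, the
    identity treated has index one higher than the case.\<close>
  then consider "i = 1" | "i = 2" | "i = 3" | "i = 5" | "i = 6" | "i = 7"
    | "i = 8" | "i = 9" | "i = 10" | "i = 11" | "i = 12" | "i = 13"
    by blast
  then show "arrow A x (zero_elem A) = x"
  proof cases
    case 1
    have "arrow A x (arrow A y z) = arrow A (arrow A x y) z"
      if "x \<in> univ A" "y \<in> univ A" "z \<in> univ A" for x y z
      using satisfies_XYZ_D[OF sat that] 1 by (simp add: A_identity_def A_identities_def)
    then show ?thesis
      using x by (metis prime_prime zero_arr_one zero_closed)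
  next
    case 2
    have "arrow A x (arrow A y z) = arrow A x (arrow A z y)"
      if "x \<in> univ A" "y \<in> univ A" "z \<in> univ A" for x y z
      using satisfies_XYZ_D[OF sat that] 2 by (simp add: A_identity_def A_identities_def)
    then show ?thesis
      using x by (metis arr_closed one_arr zero_arr_one zero_closed)
  next
    case 3
    have "arrow A x (arrow A y z) = arrow A (arrow A x z) y"
      if "x \<in> univ A" "y \<in> univ A" "z \<in> univ A" for x y z
      using satisfies_XYZ_D[OF sat that] 3 by (simp add: A_identity_def A_identities_def)
    then show ?thesis
      using x by (metis prime_prime zero_arr_one zero_closed)
  next
    case 4
    have "arrow A x (arrow A y z) = arrow A (arrow A y x) z"
      if "x \<in> univ A" "y \<in> univ A" "z \<in> univ A" for x y z
      using satisfies_XYZ_D[OF sat that] 4 by (simp add: A_identity_def A_identities_def)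
    then show ?thesis
      using x by (metis arr_closed prime_prime zero_arr_one zero_closed)
  next
    case 5
    have "arrow A x (arrow A y z) = arrow A y (arrow A z x)"
      if "x \<in> univ A" "y \<in> univ A" "z \<in> univ A" for x y z
      using satisfies_XYZ_D[OF sat that] 5 by (simp add: A_identity_def A_identities_def)
    then show ?thesis
      using x by (metis arr_closed one_arr zero_arr_one zero_closed)
  next
    case 6
    have "arrow A x (arrow A y z) = arrow A (arrow A y z) x"
      if "x \<in> univ A" "y \<in> univ A" "z \<in> univ A" for x y z
      using satisfies_XYZ_D[OF sat that] 6 by (simp add: A_identity_def A_identities_def)
    then show ?thesis
      using x by (metis one_arr zero_arr_one zero_closed)
  next
    case 7
    have "arrow A x (arrow A y z) = arrow A (arrow A z x) y"
      if "x \<in> univ A" "y \<in> univ A" "z \<in> univ A" for x y z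
      using satisfies_XYZ_D[OF sat that] 7 by (simp add: A_identity_def A_identities_def)
    then show ?thesis
      using x by (metis arr_closed one_arr zero_arr_one zero_closed)
  next
    case 8
    have "arrow A x (arrow A y z) = arrow A z (arrow A y x)"
      if "x \<in> univ A" "y \<in> univ A" "z \<in> univ A" for x y z
      using satisfies_XYZ_D[OF sat that] 8 by (simp add: A_identity_def A_identities_def)
    then show ?thesis
      using x by (metis arr_closed one_arr zero_arr_one zero_closed)
  next
    case 9
    have "arrow A x (arrow A y z) = arrow A (arrow A z y) x"
      if "x \<in> univ A" "y \<in> univ A" "z \<in> univ A" for x y z
      using satisfies_XYZ_D[OF sat that] 9 by (simp add: A_identity_def A_identities_def)
    then show ?thesis
      using x by (metis one_arr zero_arr_one zero_closed)
  next
    case 10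
    have "arrow A (arrow A x y) z = arrow A (arrow A x z) y"
      if "x \<in> univ A" "y \<in> univ A" "z \<in> univ A" for x y z
      using satisfies_XYZ_D[OF sat that] 10 by (simp add: A_identity_def A_identities_def)
    then show ?thesis
      using x by (metis arr_closed one_arr zero_arr_one zero_closed)
  next
    case 11
    have "arrow A (arrow A x y) z = arrow A (arrow A y x) z"
      if "x \<in> univ A" "y \<in> univ A" "z \<in> univ A" for x y z
      using satisfies_XYZ_D[OF sat that] 11 by (simp add: A_identity_def A_identities_def)
    then show ?thesis
      using x by (metis arr_closed one_arr prime_prime zero_arr_one zero_closed)
  next
    case 12
    have "arrow A (arrow A x y) z = arrow A (arrow A y z) x"
      if "x \<in> univ A" "y \<in> univ A" "z \<in> univ A" for x y z
      using satisfies_XYZ_D[OF sat that] 12 by (simp add: A_identity_def A_identities_def)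
    then show ?thesis
      using x by (metis arr_closed one_arr zero_arr_one zero_closed)
  qed
qed

section \<open>Words of associative type up to renaming of variables\<close>

lemma set3_eq_cases:
  assumes "{u, v, w} = {a, b, c}" "a \<noteq> b" "a \<noteq> c" "b \<noteq> c"
  shows "(u, v, w) \<in> {(a, b, c), (a, c, b), (b, a, c), (b, c, a), (c, a, b), (c, b, a)}"
proof -
  have "u \<in> {a, b, c}" "v \<in> {a, b, c}" "w \<in> {a, b, c}"
    and "a \<in> {u, v, w}" "b \<in> {u, v, w}" "c \<in> {u, v, w}"
    using assms(1) by blast+
  then show ?thesis
    using assms(2-4) by auto
qed

text \<open>The twelve words are listed relative to any ordering of the three variables, so that a
  given word can be put into standard position without loss of generality.\<close>

lemma assoc_words_eq:
  assumes "{a, b, c} = {0, 1, 2 :: nat}"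
  defines "x \<equiv> Var a" and "y \<equiv> Var b" and "z \<equiv> Var c"
  shows "a \<noteq> b" "a \<noteq> c" "b \<noteq> c"
    and "assoc_words =
      {x \<rightarrow> (y \<rightarrow> z), x \<rightarrow> (z \<rightarrow> y), y \<rightarrow> (x \<rightarrow> z), y \<rightarrow> (z \<rightarrow> x), z \<rightarrow> (x \<rightarrow> y), z \<rightarrow> (y \<rightarrow> x),
       (x \<rightarrow> y) \<rightarrow> z, (x \<rightarrow> z) \<rightarrow> y, (y \<rightarrow> x) \<rightarrow> z, (y \<rightarrow> z) \<rightarrow> x, (z \<rightarrow> x) \<rightarrow> y, (z \<rightarrow> y) \<rightarrow> x}"
    (is "_ = ?W")
proof -
  have "card {a, b, c} = 3"
    using assms(1) by simp
  then show ne: "a \<noteq> b" "a \<noteq> c" "b \<noteq> c"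
    by (auto simp: card_insert_if split: if_splits)
  have "Var ` {a, b, c} = Var ` {0, 1, 2}"
    by (simp only: assms(1))
  then have XYZ: "{x, y, z} = {X, Y, Z}"
    by (simp add: x_def y_def z_def)
  show "assoc_words = ?W"
  proof
    show "assoc_words \<subseteq> ?W"
    proof
      fix p
      assume "p \<in> assoc_words"
      then obtain u v w where uvw: "{u, v, w} = {x, y, z}"
        and p: "p = u \<rightarrow> (v \<rightarrow> w) \<or> p = (u \<rightarrow> v) \<rightarrow> w"
        unfolding assoc_words_def XYZ by blast
      have "(u, v, w) \<in> {(x, y, z), (x, z, y), (y, x, z), (y, z, x), (z, x, y), (z, y, x)}"
        using uvw ne by (intro set3_eq_cases) (simp_all add: x_def y_def z_def)
      then show "p \<in> ?W"
        using p by auto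
    qed
    show "?W \<subseteq> assoc_words"
      unfolding assoc_words_def XYZ[symmetric] by blast
  qed
qed

lemma assoc_wordE:
  assumes "p \<in> assoc_words"
  obtains a b c where "{a, b, c} = {0, 1, 2}"
    and "p = Var a \<rightarrow> (Var b \<rightarrow> Var c) \<or> p = (Var a \<rightarrow> Var b) \<rightarrow> Var c"
proof -
  obtain u v w where uvw: "{u, v, w} = Var ` {0, 1, 2}"
    and p: "p = u \<rightarrow> (v \<rightarrow> w) \<or> p = (u \<rightarrow> v) \<rightarrow> w"
    using assms unfolding assoc_words_def by auto
  then obtain a b c where abc: "u = Var a" "v = Var b" "w = Var c"
    by (metis imageE insertI1 insertI2)
  have "Var ` {a, b, c} = Var ` {0, 1, 2}"
    using uvw abc by simp
  then have "{a, b, c} = {0, 1, 2}"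
    by (subst (asm) inj_image_eq_iff) (simp_all add: inj_on_def)
  with that p abc show ?thesis
    by blast
qed

lemma satisfies_commute: "satisfies A (p, q) \<longleftrightarrow> satisfies A (q, p)"
  by (auto simp: satisfies_def)

text \<open>Renaming the variables so that one side becomes \<open>x \<rightarrow> (y \<rightarrow> z)\<close> or \<open>(x \<rightarrow> y) \<rightarrow> z\<close>
  leaves (A1)--(A14), up to exchanging the two sides.\<close>

lemma assoc_identity_cases:
  fixes p q
  assumes "p \<in> assoc_words" "q \<in> assoc_words" "p \<noteq> q"
  shows "\<exists>i\<in>{1..14}. \<forall>A :: 'a zroupoid. satisfies A (p, q) \<longleftrightarrow> satisfies A (A_identity i)"
proof -
  define same where "same p q i \<longleftrightarrow>
    (\<forall>A :: 'a zroupoid. satisfies A (p, q) \<longleftrightarrow> satisfies A (A_identity i))" for p q i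
  have same_commute: "same p q i \<longleftrightarrow> same q p i" for p q i
    by (simp add: same_def satisfies_commute)
  have sameD: ?thesis if "same p q i" "i \<in> {1..14}" for i
    using that by (auto simp: same_def)
  have right: "\<exists>i\<in>{1..14}. same p q i"
    if abc: "{a, b, c} = {0, 1, 2}" and p: "p = Var a \<rightarrow> (Var b \<rightarrow> Var c)"
      and q: "q \<in> assoc_words" "p \<noteq> q" for p q a b c
  proof -
    note ne = assoc_words_eq(1-3)[OF abc]
    note ternary = satisfies_ternary[OF ne]
    let ?x = "Var a" and ?y = "Var b" and ?z = "Var c"
    have R: "same (?x \<rightarrow> (?y \<rightarrow> ?z)) ((?x \<rightarrow> ?y) \<rightarrow> ?z) 1"
      "same (?x \<rightarrow> (?y \<rightarrow> ?z)) (?x \<rightarrow> (?z \<rightarrow> ?y)) 2"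
      "same (?x \<rightarrow> (?y \<rightarrow> ?z)) ((?x \<rightarrow> ?z) \<rightarrow> ?y) 3"
      "same (?x \<rightarrow> (?y \<rightarrow> ?z)) (?y \<rightarrow> (?x \<rightarrow> ?z)) 4"
      "same (?x \<rightarrow> (?y \<rightarrow> ?z)) ((?y \<rightarrow> ?x) \<rightarrow> ?z) 5"
      "same (?x \<rightarrow> (?y \<rightarrow> ?z)) (?y \<rightarrow> (?z \<rightarrow> ?x)) 6"
      "same (?x \<rightarrow> (?y \<rightarrow> ?z)) ((?y \<rightarrow> ?z) \<rightarrow> ?x) 7"
      "same (?x \<rightarrow> (?y \<rightarrow> ?z)) ((?z \<rightarrow> ?x) \<rightarrow> ?y) 8"
      "same (?x \<rightarrow> (?y \<rightarrow> ?z)) (?z \<rightarrow> (?y \<rightarrow> ?x)) 9"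
      "same (?x \<rightarrow> (?y \<rightarrow> ?z)) ((?z \<rightarrow> ?y) \<rightarrow> ?x) 10"
      unfolding same_def by (simp_all add: ternary ne ne[symmetric] satisfies_XYZ A_identity_def A_identities_def)
    \<comment> \<open>The inverse rotation: exchanging sides and renaming cyclically gives (A6)
      again. This is how eleven words lead to only ten identities.\<close>
    have R6: "same (?x \<rightarrow> (?y \<rightarrow> ?z)) (?z \<rightarrow> (?x \<rightarrow> ?y)) 6"
      unfolding same_def by (simp add: ternary ne ne[symmetric] satisfies_XYZ A_identity_def A_identities_def) metis
    show ?thesis
      using q(1) q(2) R R6 unfolding assoc_words_eq(4)[OF abc] p by auto
  qed
  have left: "\<exists>i\<in>{1..14}. same p q i"
    if abc: "{a, b, c} = {0, 1, 2}" and p: "p = (Var a \<rightarrow> Var b) \<rightarrow> Var c"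
      and q: "q = (Var d \<rightarrow> Var e) \<rightarrow> Var f" "q \<in> assoc_words" "p \<noteq> q" for p q a b c d e f
  proof -
    note ne = assoc_words_eq(1-3)[OF abc]
    note ternary = satisfies_ternary[OF ne]
    let ?x = "Var a" and ?y = "Var b" and ?z = "Var c"
    have L: "same ((?x \<rightarrow> ?y) \<rightarrow> ?z) ((?x \<rightarrow> ?z) \<rightarrow> ?y) 11"
      "same ((?x \<rightarrow> ?y) \<rightarrow> ?z) ((?y \<rightarrow> ?x) \<rightarrow> ?z) 12"
      "same ((?x \<rightarrow> ?y) \<rightarrow> ?z) ((?y \<rightarrow> ?z) \<rightarrow> ?x) 13"
      "same ((?x \<rightarrow> ?y) \<rightarrow> ?z) ((?z \<rightarrow> ?y) \<rightarrow> ?x) 14"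
      unfolding same_def
      by (simp_all add: ternary ne ne[symmetric] satisfies_XYZ A_identity_def A_identities_def)
    \<comment> \<open>Again the inverse rotation, this time of (A13).\<close>
    have L13: "same ((?x \<rightarrow> ?y) \<rightarrow> ?z) ((?z \<rightarrow> ?x) \<rightarrow> ?y) 13"
      unfolding same_def
      by (simp add: ternary ne ne[symmetric] satisfies_XYZ A_identity_def A_identities_def) metis
    show ?thesis
      using q L L13 unfolding assoc_words_eq(4)[OF abc] p by auto
  qed
  obtain a b c where abc: "{a, b, c} = {0, 1, 2}"
    and p: "p = Var a \<rightarrow> (Var b \<rightarrow> Var c) \<or> p = (Var a \<rightarrow> Var b) \<rightarrow> Var c"
    using assms(1) by (rule assoc_wordE)
  obtain d e f where def: "{d, e, f} = {0, 1, 2}"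
    and q: "q = Var d \<rightarrow> (Var e \<rightarrow> Var f) \<or> q = (Var d \<rightarrow> Var e) \<rightarrow> Var f"
    using assms(2) by (rule assoc_wordE)
  \<comment> \<open>If either word is bracketed to the right, it is taken as the left side,
    exchanging sides if necessary; otherwise both are bracketed to the left.\<close>
  have "\<exists>i\<in>{1..14}. same p q i"
    using p q right[OF abc _ assms(2,3)] right[OF def _ assms(1) assms(3)[symmetric]]
      left[OF abc _ _ assms(2,3)] same_commute by blast
  then show ?thesis
    by (simp only: same_def)
qed

section \<open>The fourteen identities relative to the symmetric zroupoids\<close>

lemma S_variety_eq: "S_variety i = {A \<in> symmetric_I_zroupoids. satisfies A (A_identity i)}"
  by (auto simp: S_variety_def A_variety_def symmetric_I_zroupoids_def variety_def)

text \<open>Here the arrow is commutative and left-commutative, hence associative, so all twelve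
  words have the same value.\<close>

lemma SL_satisfies_assoc:
  assumes A: "A \<in> SL" and "p \<in> assoc_words" "q \<in> assoc_words"
  shows "satisfies A (p, q)"
proof -
  interpret symmetric_zroupoid "univ A" "arrow A" "zero_elem A"
    using A SL_subset by (auto intro: symmetric_zroupoid)
  have assoc: "arrow A (arrow A x y) z = arrow A x (arrow A y z)"
    if "x \<in> univ A" "y \<in> univ A" "z \<in> univ A" for x y z
    using that SL_D(2)[OF A, of "arrow A x y" z] SL_D(2)[OF A, of z y] arr_left_commute[of z x y]
    by simp
  have eval: "eval_trm A v r = arrow A (v 0) (arrow A (v 1) (v 2))"
    if v: "range v \<subseteq> univ A" and r: "r \<in> assoc_words" for v r
  proof -
    have "v n \<in> univ A" for n
      using v by auto
    then show ?thesis
      using r unfolding assoc_words_eq(4)[OF refl]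
      by (elim insertE emptyE) (simp_all add: assoc arr_left_commute SL_D(2)[OF A])
  qed
  show ?thesis
    using assms(2,3) by (simp add: satisfies_def eval)
qed

lemma S_variety_cases:
  assumes "i \<in> {1..14}"
  shows "S_variety i = (if i = 4 then symmetric_I_zroupoids else if i = 14 then S_variety 14 else SL)"
proof -
  have word: "fst (A_identity i) \<in> assoc_words" "snd (A_identity i) \<in> assoc_words"
  proof -
    have "set A_identities \<subseteq> assoc_words \<times> assoc_words"
      by (simp add: A_identities_def assoc_words_eq(4)[OF refl])
    moreover have "length A_identities = 14"
      by (simp add: A_identities_def)
    then have "A_identity i \<in> set A_identities"
      using assms unfolding A_identity_def by (intro nth_mem) auto
    ultimately show "fst (A_identity i) \<in> assoc_words" "snd (A_identity i) \<in> assoc_words"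
      by auto
  qed
  consider "i = 4" | "i = 14" | "i \<in> {1..14} - {4, 14}"
    using assms by blast
  then show ?thesis
  proof cases
    case 1
    have "satisfies A (A_identity 4)" if "A \<in> symmetric_I_zroupoids" for A :: "'a zroupoid"
    proof -
      interpret symmetric_zroupoid "univ A" "arrow A" "zero_elem A"
        using that by (rule symmetric_zroupoid)
      show ?thesis
        by (auto simp: A_identity_def A_identities_def satisfies_XYZ intro: arr_left_commute)
    qed
    then show ?thesis
      using 1 by (auto simp: S_variety_eq)
  next
    case 3
    have "satisfies A (A_identity i)" if "A \<in> SL" for A :: "'a zroupoid"
      using SL_satisfies_assoc[OF that word] by simp
    then show ?thesis
      using 3 SL_subset in_SL_if_satisfies_A_identity[OF _ _ 3] by (auto simp: S_variety_eq)
  qed simp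
qed

section \<open>Separating algebras\<close>

text \<open>Brings finite counterexamples into the ambient type: an infinite type has a subset of
  the required size, and the operations are transported along a bijection \<open>g\<close> with
  inverse \<open>h\<close>.\<close>

lemma ex_copy:
  fixes A :: "'b zroupoid"
  assumes "infinite (UNIV :: 'a set)" and A: "is_algebra A" "finite (univ A)"
  obtains B :: "'a zroupoid" where "is_algebra B" "\<And>e. satisfies B e \<longleftrightarrow> satisfies A e"
proof -
  obtain C :: "'a set" where "finite C" "card C = card (univ A)"
    using infinite_arbitrarily_large[OF assms(1)] by blast
  then obtain g where g: "bij_betw g (univ A) C"
    using A(2) finite_same_card_bij by metis
  define h where "h = inv_into (univ A) g"
  have hg: "h (g x) = x" if "x \<in> univ A" for x
    unfolding h_def using g that by (simp add: bij_betw_def)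
  have gh: "g (h x) = x" "h x \<in> univ A" if "x \<in> C" for x
    unfolding h_def using g that
    by (auto simp: bij_betw_def f_inv_into_f inv_into_into)
  have gC: "g x \<in> C" if "x \<in> univ A" for x
    using g that by (auto simp: bij_betw_def)
  define B where "B = \<lparr>univ = C, arrow = \<lambda>x y. g (arrow A (h x) (h y)), zero_elem = g (zero_elem A)\<rparr>"
  have B: "is_algebra B"
    using A(1) by (auto simp: is_algebra_def B_def gC gh)
  have eval: "eval_trm B (g \<circ> v) t = g (eval_trm A v t)" if "range v \<subseteq> univ A" for v t
    using that by (induction t) (simp_all add: B_def hg eval_trm_closed[OF A(1)])
  have "satisfies B e \<longleftrightarrow> satisfies A e" for e
  proof
    assume sat: "satisfies B e"
    show "satisfies A e"
      unfolding satisfies_def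
    proof (intro allI impI)
      fix v :: "nat \<Rightarrow> 'b"
      assume v: "range v \<subseteq> univ A"
      then have "range (g \<circ> v) \<subseteq> univ B"
        by (auto simp: B_def gC)
      then have "g (eval_trm A v (fst e)) = g (eval_trm A v (snd e))"
        using sat v by (auto simp: satisfies_def simp flip: eval)
      then show "eval_trm A v (fst e) = eval_trm A v (snd e)"
        by (metis hg eval_trm_closed[OF A(1) v])
    qed
  next
    assume sat: "satisfies A e"
    show "satisfies B e"
      unfolding satisfies_def
    proof (intro allI impI)
      fix v :: "nat \<Rightarrow> 'a"
      assume "range v \<subseteq> univ B"
      then have vC: "v n \<in> C" for n
        by (auto simp: B_def)
      define w where "w = h \<circ> v"
      have "range w \<subseteq> univ A" and "v = g \<circ> w"
        using vC by (auto simp: w_def gh fun_eq_iff)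
      then show "eval_trm B v (fst e) = eval_trm B v (snd e)"
        using sat by (simp add: eval satisfies_def)
    qed
  qed
  with B that show ?thesis
    by blast
qed

text \<open>The two-element Boolean algebra under implication. Setting \<open>y\<close> to
  \<open>True\<close> in (A14) leaves the false equation \<open>z = x\<close>.\<close>

definition boolean_zroupoid :: "bool zroupoid" where
  "boolean_zroupoid = \<lparr>univ = UNIV, arrow = (\<longrightarrow>), zero_elem = False\<rparr>"

text \<open>The free join-semilattice with unit on two generators, with the automorphism exchanging
  the generators as \<open>'\<close>; both lattice operations are the join.\<close>

definition swap_zroupoid :: "(bool \<times> bool) zroupoid" where
  "swap_zroupoid = \<lparr>univ = UNIV, arrow = \<lambda>x y. (snd x \<or> fst y, fst x \<or> snd y),
    zero_elem = (False, False)\<rparr>"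

lemma boolean_zroupoid:
  "is_algebra boolean_zroupoid"
  "e \<in> I_identities \<union> {X\<acute>\<acute> \<approx> X, X \<sqinter>\<^sub>t Y \<approx> Y \<sqinter>\<^sub>t X, (X \<rightarrow> Y) \<rightarrow> X \<approx> X, X \<rightarrow> X \<approx> Zero\<acute>} \<Longrightarrow>
    satisfies boolean_zroupoid e"
  "\<not> satisfies boolean_zroupoid (A_identity 14)"
    apply (simp add: boolean_zroupoid_def is_algebra_def)
   apply (auto simp: boolean_zroupoid_def I_identities_def satisfies_def)[1]
  apply (simp add: boolean_zroupoid_def A_identity_def A_identities_def satisfies_XYZ)
  by blast

text \<open>The arrow is the join of the swapped first argument with the second, so
  \<open>(x \<rightarrow> y) \<rightarrow> z\<close> is the join of \<open>x\<close>, the swapped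
  \<open>y\<close>, and \<open>z\<close>, which is symmetric in \<open>x\<close> and
  \<open>z\<close>. Prime moves both generators.\<close>

lemma swap_zroupoid:
  "is_algebra swap_zroupoid"
  "e \<in> I_identities \<union> {X\<acute>\<acute> \<approx> X, X \<sqinter>\<^sub>t Y \<approx> Y \<sqinter>\<^sub>t X, A_identity 14} \<Longrightarrow>
    satisfies swap_zroupoid e"
  "\<not> satisfies swap_zroupoid (X\<acute> \<approx> X)"
    apply (simp add: swap_zroupoid_def is_algebra_def)
   apply (auto simp: swap_zroupoid_def I_identities_def satisfies_def A_identity_def A_identities_def)[1]
  apply (simp add: swap_zroupoid_def satisfies_XYZ)
  by blast

section \<open>The classification and the strict inclusions\<close>

theorem theorem5p7:
  assumes "infinite (UNIV :: 'a set)"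
  shows "(assoc_type_subvarieties :: 'a zroupoid set set)
           = {SL, S_variety 14, symmetric_I_zroupoids}
       \<and> (\<forall>i\<in>{1..14}. (S_variety i :: 'a zroupoid set)
             \<in> {SL, S_variety 14, symmetric_I_zroupoids})
       \<and> (SL :: 'a zroupoid set) \<noteq> S_variety 14
       \<and> (SL :: 'a zroupoid set) \<noteq> symmetric_I_zroupoids
       \<and> (S_variety 14 :: 'a zroupoid set) \<noteq> symmetric_I_zroupoids
       \<and> (SL :: 'a zroupoid set) \<subset> S_variety 14
       \<and> (S_variety 14 :: 'a zroupoid set) \<subset> symmetric_I_zroupoids
       \<and> \<not> (BA :: 'a zroupoid set) \<subseteq> S_variety 14"
proof -
  let ?S = "symmetric_I_zroupoids :: 'a zroupoid set"
  have words: "X \<rightarrow> (Y \<rightarrow> Z) \<in> assoc_words" "(X \<rightarrow> Y) \<rightarrow> Z \<in> assoc_words" "(Z \<rightarrow> Y) \<rightarrow> X \<in> assoc_words"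
    by (simp_all add: assoc_words_eq(4)[OF refl])
  have cases: "(S_variety i :: 'a zroupoid set) \<in> {SL, S_variety 14, ?S}" if "i \<in> {1..14}" for i
    by (subst S_variety_cases[OF that]) simp
  have 14: "A_identity 14 = ((X \<rightarrow> Y) \<rightarrow> Z, (Z \<rightarrow> Y) \<rightarrow> X)"
    by (simp add: A_identity_def A_identities_def)
  have le: "(SL :: 'a zroupoid set) \<subseteq> S_variety 14"
    unfolding S_variety_eq 14 using SL_subset SL_satisfies_assoc[OF _ words(2,3)] by blast
  have type: "(assoc_type_subvarieties :: 'a zroupoid set set) = {SL, S_variety 14, ?S}"
  proof
    show "(assoc_type_subvarieties :: 'a zroupoid set set) \<subseteq> {SL, S_variety 14, ?S}"
    proof
      fix V :: "'a zroupoid set"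
      assume "V \<in> assoc_type_subvarieties"
      then obtain p q where V: "V = {A \<in> ?S. satisfies A (p, q)}"
        and pq: "p \<in> assoc_words" "q \<in> assoc_words"
        unfolding assoc_type_subvarieties_def by blast
      show "V \<in> {SL, S_variety 14, ?S}"
      proof (cases "p = q")
        case True
        then show ?thesis
          by (simp add: V satisfies_def)
      next
        case False
        then obtain i where "i \<in> {1..14}"
          and "\<And>A :: 'a zroupoid. satisfies A (p, q) \<longleftrightarrow> satisfies A (A_identity i)"
          using assoc_identity_cases[OF pq] by blast
        then show ?thesis
          using cases[of i] by (simp add: V S_variety_eq)
      qed
    qed
    have mem: "{A \<in> ?S. satisfies A (p, q)} \<in> assoc_type_subvarieties"
      if "p \<in> assoc_words" "q \<in> assoc_words" for p q
      using that unfolding assoc_type_subvarieties_def by blast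
    \<comment> \<open>An identity with equal sides cuts out the whole variety.\<close>
    have "?S \<in> assoc_type_subvarieties"
      using mem[OF words(1,1)] by (simp add: satisfies_def)
    moreover have "S_variety 14 \<in> (assoc_type_subvarieties :: 'a zroupoid set set)"
      using mem[OF words(2,3)] by (simp only: S_variety_eq 14)
    \<comment> \<open>Associativity, (A1), serves as the defining identity.\<close>
    moreover have "SL \<in> (assoc_type_subvarieties :: 'a zroupoid set set)"
      using mem[OF words(1,2)] S_variety_cases[of 1, where 'a = 'a]
      by (simp add: S_variety_eq A_identity_def A_identities_def)
    ultimately show "{SL, S_variety 14, ?S} \<subseteq> assoc_type_subvarieties"
      by simp
  qed
  \<comment> \<open>\<open>B\<close> lies in \<open>BA\<close> and in \<open>?S\<close> but violates
    (A14), which gives both the strictness of the upper inclusion and the failure of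
    \<open>BA \<subseteq> S_variety 14\<close>. Below, \<open>C\<close> gives the strictness of the
    lower inclusion.\<close>
  obtain B :: "'a zroupoid" where B: "is_algebra B" "\<And>e. satisfies B e \<longleftrightarrow> satisfies boolean_zroupoid e"
    by (rule ex_copy[OF assms boolean_zroupoid(1)]) (simp add: boolean_zroupoid_def, blast)
  have "B \<in> ?S" "B \<in> BA"
    unfolding symmetric_I_zroupoids_def BA_def variety_def
    using B(1) boolean_zroupoid(2)[folded B(2)] by blast+
  moreover have "B \<notin> S_variety 14"
    using boolean_zroupoid(3) by (simp add: S_variety_eq B(2))
  moreover
  obtain C :: "'a zroupoid" where C: "is_algebra C" "\<And>e. satisfies C e \<longleftrightarrow> satisfies swap_zroupoid e"
    by (rule ex_copy[OF assms swap_zroupoid(1)]) (simp add: swap_zroupoid_def, blast)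
  have "C \<in> S_variety 14"
    unfolding S_variety_eq symmetric_I_zroupoids_def variety_def
    using C(1) swap_zroupoid(2)[folded C(2)] by blast
  moreover have "C \<notin> SL"
    using swap_zroupoid(3) by (simp add: SL_def variety_def C(2))
  moreover have "(S_variety 14 :: 'a zroupoid set) \<subseteq> ?S"
    by (auto simp: S_variety_eq)
  ultimately show ?thesis
    using type cases le by blast
qed

end
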